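(* Let $a$ be an odd integer, let $k,m$ be positive integers with $m\ge 5$, and let $b\in\{0,2,4,\ldots\}$. Then $$\begin{aligned}E_{2^mk+b}^{(a)}-E_b^{(a)}\equiv{}& 2^{m}k\{7ab^6-6ab^5+(3a^3-14a)b^4+(4a^3+56a)b^3\\&-(6a^4+35a^3-12a^2+106a-122)b^2+(38a^3-8a-256)b\\&+(70a^3+64a^2-81a+448)\\&+2^{m}k(b^4+2b^3+2ab^2+(a^3+2a)b+16-a^3)\}\pmod{2^{m+10}}.\end{aligned}$$
   Context: For a nonzero integer $a$, the sequence $\{E_n^{(a)}\}_{n\ge 0}$ is the sequence of integers defined recursively by $$\sum_{j=0}^{\lfloor n/2\rfloor}\binom{n}{2j}a^{2j}E_{n-2j}^{(a)}=(1-a)^n\quad(n=0,1,2,\ldots).$$ *)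

theory Defs
  imports "HOL-Number_Theory.Number_Theory"
begin

text \<open>
  The defining identity of the sequence, \<open>gen_euler_sum\<close> below, solved for its \<open>j = 0\<close>
  term. The paper requires \<open>a \<noteq> 0\<close>; for \<open>a = 0\<close> the function takes the value \<open>1\<close>
  everywhere, which plays no role when \<open>a\<close> is odd.
\<close>

fun gen_euler :: "int \<Rightarrow> nat \<Rightarrow> int" where
  "gen_euler a n =
     (1 - a) ^ n - (\<Sum>j = 1..n div 2. int (n choose (2 * j)) * a ^ (2 * j) * gen_euler a (n - 2 * j))"

declare gen_euler.simps [simp del]

lemma gen_euler_sum:
  "(\<Sum>j = 0..n div 2. int (n choose (2 * j)) * a ^ (2 * j) * gen_euler a (n - 2 * j)) = (1 - a) ^ n"
  by (subst sum.atLeast_Suc_atMost) (simp_all add: gen_euler.simps [of a n])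

lemma gen_euler_unique:
  assumes "\<And>n. (\<Sum>j = 0..n div 2. int (n choose (2 * j)) * a ^ (2 * j) * F (n - 2 * j)) = (1 - a) ^ n"
  shows "F n = gen_euler a n"
proof (induction n rule: less_induct)
  case (less n)
  have "(\<Sum>j = 1..n div 2. int (n choose (2 * j)) * a ^ (2 * j) * F (n - 2 * j)) =
        (\<Sum>j = 1..n div 2. int (n choose (2 * j)) * a ^ (2 * j) * gen_euler a (n - 2 * j))"
    by (rule sum.cong) (auto simp: less.IH)
  moreover have "F n + (\<Sum>j = 1..n div 2. int (n choose (2 * j)) * a ^ (2 * j) * F (n - 2 * j)) = (1 - a) ^ n"
    using assms [of n] by (simp add: sum.atLeast_Suc_atMost)
  ultimately show ?case
    by (simp add: gen_euler.simps [of a n])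
qed

end

theory Submission
  imports Defs "HOL-Computational_Algebra.Polynomial"
begin

text \<open>
  Let \<open>F\<close> be the linear functional on polynomials in \<open>w\<close> with \<open>F (w\<^sup>n) = E\<^sub>n\<close>. The defining identity of
  the sequence says \<open>F (p (w + a) + p (w - a)) = 2 p (1 - a)\<close>. Put \<open>v = w\<^sup>2 - 1\<close> and \<open>g\<^sub>j = F (v\<^sup>j)\<close>.
  Taking \<open>p = (w\<^sup>2 - a\<^sup>2 - 1)\<^sup>j\<close> gives a recurrence for \<open>g\<^sub>j\<close>, which shows that \<open>2\<^sup>j\<close> divides \<open>g\<^sub>j\<close> and,
  for odd \<open>a\<close>, that \<open>g\<^sub>j\<close> vanishes modulo \<open>2\<^sup>1\<^sup>4\<close> for \<open>8 \<le> j \<le> 13\<close>. With \<open>b = 2 c\<close> and \<open>2\<^sup>m k = 2 K\<close>,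
  expanding \<open>((1 + v)\<^sup>K - 1) (1 + v)\<^sup>c\<close> writes the difference \<open>E\<^bsub>2K+2c\<^esub> - E\<^bsub>2c\<^esub>\<close> as the sum of
  \<open>(c choose i) (K choose s) g\<^bsub>i+s\<^esub>\<close> over \<open>i \<ge> 0\<close> and \<open>s \<ge> 1\<close>. Since \<open>K choose s\<close> is an integer
  multiple of \<open>K\<close> divided by \<open>s\<close>, the terms with \<open>i + s \<ge> 8\<close> vanish modulo \<open>2\<^sup>1\<^sup>1 K\<close>; the others are compared with the
  Newton expansion of the right-hand side in \<open>c\<close>, one coefficient \<open>c choose i\<close> at a time.
\<close>

section \<open>The linear functional attached to the sequence\<close>

definition euler_functional :: "int \<Rightarrow> int poly \<Rightarrow> int" where
  "euler_functional a p = (\<Sum>i\<le>degree p. coeff p i * gen_euler a i)"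

text \<open>Coefficients above the degree vanish. A common bound puts polynomials of different
  degrees over one summation range, which gives additivity even when leading terms cancel.\<close>

lemma euler_functional_bound:
  assumes "degree p \<le> n"
  shows "euler_functional a p = (\<Sum>i\<le>n. coeff p i * gen_euler a i)"
  unfolding euler_functional_def
  using assms by (intro sum.mono_neutral_left) (auto intro: coeff_eq_0)

lemma euler_functional_add:
  "euler_functional a (p + q) = euler_functional a p + euler_functional a q"
proof -
  let ?n = "max (degree p) (degree q)"
  show ?thesis
    by (simp add: euler_functional_bound[of _ ?n] degree_add_le sum.distrib algebra_simps)
qed

lemma euler_functional_smult: "euler_functional a (smult c p) = c * euler_functional a p"
  by (simp add: euler_functional_bound[of _ "degree p"] degree_smult_le sum_distrib_left mult.assoc)

lemma euler_functional_0 [simp]: "euler_functional a 0 = 0"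
  by (simp add: euler_functional_def)

lemma euler_functional_sum:
  "euler_functional a (\<Sum>i\<in>A. f i) = (\<Sum>i\<in>A. euler_functional a (f i))"
  by (induction A rule: infinite_finite_induct) (simp_all add: euler_functional_add)

lemma euler_functional_of_nat_mult:
  "euler_functional a (of_nat n * p) = int n * euler_functional a p"
  by (simp add: of_nat_poly euler_functional_smult)

lemma euler_functional_diff:
  "euler_functional a (p - q) = euler_functional a p - euler_functional a q"
  using euler_functional_add[of a "p - q" q] by simp

lemma euler_functional_monom: "euler_functional a (monom 1 n) = gen_euler a n"
  by (simp add: euler_functional_bound[of _ n] degree_monom_le if_distrib[of "\<lambda>x. x * _"] cong: if_cong)

section \<open>The defining identity as a shift identity for the functional\<close>

lemma sum_atMost_even_only:
  fixes f :: "nat \<Rightarrow> 'a::comm_monoid_add"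
  shows "(\<Sum>k\<le>n. if even k then f k else 0) = (\<Sum>i\<le>n div 2. f (2 * i))"
proof -
  have "(\<Sum>k\<le>n. if even k then f k else 0) = (\<Sum>k\<in>{k. k \<le> n \<and> even k}. f k)"
    by (intro sum.mono_neutral_cong_right) auto
  also have "\<dots> = (\<Sum>i\<le>n div 2. f (2 * i))"
    by (rule sum.reindex_bij_witness[of _ "\<lambda>i. 2 * i" "\<lambda>k. k div 2"]) auto
  finally show ?thesis .
qed

text \<open>Odd powers of \<open>y\<close> cancel and even ones double. This is used with
  \<open>y\<close> the constant \<open>a\<close>, where the defining sum of the sequence appears,
  and with \<open>y = 2 a w\<close>, where only powers of \<open>w ^ 2\<close> survive.\<close>

lemma binomial_add_diff:
  fixes x y :: "'a::comm_ring_1"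
  shows "(x + y) ^ n + (x - y) ^ n
    = 2 * (\<Sum>i\<le>n div 2. of_nat (n choose (2 * i)) * x ^ (n - 2 * i) * y ^ (2 * i))"
proof -
  have "(y + x) ^ n + (- y + x) ^ n
      = (\<Sum>k\<le>n. of_nat (n choose k) * y ^ k * x ^ (n - k) + of_nat (n choose k) * (- y) ^ k * x ^ (n - k))"
    by (simp only: binomial_ring sum.distrib)
  also have "\<dots> = (\<Sum>k\<le>n. if even k then 2 * (of_nat (n choose k) * x ^ (n - k) * y ^ k) else 0)"
    by (intro sum.cong) (auto simp: algebra_simps)
  finally show ?thesis
    unfolding sum_atMost_even_only by (simp add: sum_distrib_left add.commute)
qed

lemma pcompose_monom_1: "pcompose (monom c n) p = smult c (p ^ n)"
  by (induction n) (simp_all add: monom_Suc monom_0 pcompose_pCons)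

lemma smult_sum_right: "smult c (\<Sum>i\<in>A. f i) = (\<Sum>i\<in>A. smult c (f i))"
  by (induction A rule: infinite_finite_induct) (simp_all add: smult_add_right)

lemma pcompose_power: "pcompose (p ^ n) q = pcompose p q ^ n"
  by (induction n) (simp_all add: pcompose_1 pcompose_mult)

text \<open>By linearity it is enough to take a monomial for \<open>p\<close>; the left-hand side is
  then twice the sum in \<open>gen_euler_sum\<close>.\<close>

lemma euler_functional_shift:
  "euler_functional a (pcompose p [:a, 1:] + pcompose p [:- a, 1:]) = 2 * poly p (1 - a)"
proof -
  have mon: "euler_functional a ([:a, 1:] ^ n + [:- a, 1:] ^ n) = 2 * (1 - a) ^ n" for n
  proof -
    have "[:a, 1:] ^ n + [:- a, 1:] ^ n = (monom 1 1 + [:a:]) ^ n + (monom 1 1 - [:a:]) ^ n"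
      by (simp add: monom_Suc monom_0)
    also have "\<dots> = smult 2 (\<Sum>i\<le>n div 2.
        smult (int (n choose (2 * i)) * a ^ (2 * i)) (monom 1 (n - 2 * i)))"
      unfolding binomial_add_diff
      by (simp add: numeral_poly of_nat_poly poly_const_pow monom_power mult.commute)
    finally show ?thesis
      using gen_euler_sum[of n a]
      by (simp add: euler_functional_smult euler_functional_sum euler_functional_monom atMost_atLeast0)
  qed
  have "pcompose p [:a, 1:] + pcompose p [:- a, 1:]
      = (\<Sum>i\<le>degree p. smult (coeff p i) ([:a, 1:] ^ i + [:- a, 1:] ^ i))"
    by (subst (1 2) poly_as_sum_of_monoms[symmetric])
       (simp add: pcompose_sum pcompose_monom_1 sum.distrib smult_add_right)
  then show ?thesis
    by (simp add: euler_functional_sum euler_functional_smult mon poly_altdef sum_distrib_left mult_ac)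
qed

section \<open>Forward differences of the even-indexed terms: recurrence, expansion,
  divisibility\<close>

definition even_euler_diff :: "int \<Rightarrow> nat \<Rightarrow> int" where
  "even_euler_diff a j = euler_functional a ([:-1, 0, 1:] ^ j)"

lemma monom_2_eq: "monom 1 2 = 1 + [:-1, 0, 1::int:]"
  by (simp add: monom_altdef numeral_2_eq_2 one_pCons)

text \<open>With \<open>v = w ^ 2 - 1\<close>, replacing \<open>w\<close> by \<open>w + a\<close> or
  \<open>w - a\<close> turns \<open>w ^ 2 - a ^ 2 - 1\<close> into \<open>v + 2 a w\<close> or
  \<open>v - 2 a w\<close>, and \<open>(2 a w) ^ 2 = 4 a ^ 2 (1 + v)\<close> is again a polynomial
  in \<open>v\<close>. The value at \<open>1 - a\<close> is \<open>- 2 a\<close>. The term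
  \<open>i = 0\<close> is \<open>even_euler_diff a j\<close>; the others have indices at most
  \<open>j - i\<close>, so this is a recurrence.\<close>

lemma even_euler_diff_recurrence:
  "(\<Sum>i\<le>j div 2. int (j choose (2 * i)) * (4 * a\<^sup>2) ^ i *
      (\<Sum>l\<le>i. int (i choose l) * even_euler_diff a (j - 2 * i + l))) = (- 2 * a) ^ j"
proof -
  let ?v = "[:-1, 0, 1:] :: int poly" and ?q = "[:- (a\<^sup>2 + 1), 0, 1:] :: int poly"
  define d where "d i = j - 2 * i" for i
  have pow: "[:0, 2 * a:] ^ (2 * i) =
      smult ((4 * a\<^sup>2) ^ i) (\<Sum>l\<le>i. of_nat (i choose l) * ?v ^ l)" for i
  proof -
    have "[:0, 2 * a:] ^ (2 * i) = (smult (4 * a\<^sup>2) (1 + ?v)) ^ i"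
      by (simp add: power_mult power2_eq_square one_pCons)
    also have "(1 + ?v) ^ i = (\<Sum>l\<le>i. of_nat (i choose l) * ?v ^ l)"
      using binomial_ring[of ?v 1 i] by (simp add: add.commute)
    then have "(smult (4 * a\<^sup>2) (1 + ?v)) ^ i =
        smult ((4 * a\<^sup>2) ^ i) (\<Sum>l\<le>i. of_nat (i choose l) * ?v ^ l)"
      by (simp only: smult_power)
    finally show ?thesis .
  qed
  have "pcompose (?q ^ j) [:a, 1:] + pcompose (?q ^ j) [:- a, 1:]
      = (?v + [:0, 2 * a:]) ^ j + (?v - [:0, 2 * a:]) ^ j"
    by (simp add: pcompose_power pcompose_pCons power2_eq_square)
  also have "\<dots> = smult 2 (\<Sum>i\<le>j div 2. smult (int (j choose (2 * i)) * (4 * a\<^sup>2) ^ i)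
      (\<Sum>l\<le>i. of_nat (i choose l) * ?v ^ (d i + l)))"
    unfolding binomial_add_diff pow d_def[symmetric]
    by (simp add: numeral_poly of_nat_poly sum_distrib_left power_add smult_sum_right mult_ac)
  finally have eq: "pcompose (?q ^ j) [:a, 1:] + pcompose (?q ^ j) [:- a, 1:] = \<dots>" .
  have "2 * (\<Sum>i\<le>j div 2. int (j choose (2 * i)) * (4 * a\<^sup>2) ^ i *
      (\<Sum>l\<le>i. int (i choose l) * even_euler_diff a (j - 2 * i + l))) = 2 * poly (?q ^ j) (1 - a)"
    unfolding euler_functional_shift[symmetric] eq
    by (simp add: euler_functional_smult euler_functional_sum euler_functional_of_nat_mult
        even_euler_diff_def d_def)
  also have "poly (?q ^ j) (1 - a) = (- 2 * a) ^ j"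
    by (simp add: power2_eq_square algebra_simps)
  finally show ?thesis
    by simp
qed

text \<open>\<open>even_euler_diff a j\<close> is the \<open>j\<close>-th forward difference at 0 of
  the even-indexed terms, and this is Newton's formula applied to both \<open>n\<close> and
  \<open>c\<close>. Subtracting the second term removes \<open>s = 0\<close>, so each summand
  contains some \<open>n choose s\<close> with \<open>s \<ge> 1\<close>, the source of divisibility
  by powers of 2 in \<open>n\<close>.\<close>

lemma gen_euler_even_diff:
  "gen_euler a (2 * (n + c)) - gen_euler a (2 * c)
    = (\<Sum>i\<le>c. int (c choose i) * (\<Sum>s=1..n. int (n choose s) * even_euler_diff a (i + s)))"
proof -
  let ?v = "[:-1, 0, 1:] :: int poly"
  have exp: "monom 1 (2 * n) = (\<Sum>s\<le>n. of_nat (n choose s) * ?v ^ s)" for n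
  proof -
    have "monom 1 (2 * n) = (1 + ?v) ^ n"
      by (simp add: monom_2_eq[symmetric] monom_power)
    also have "\<dots> = (\<Sum>s\<le>n. of_nat (n choose s) * ?v ^ s)"
      using binomial_ring[of ?v 1 n] by (simp add: add.commute)
    finally show ?thesis .
  qed
  have "monom 1 (2 * (n + c)) - monom 1 (2 * c) = monom (1::int) (2 * c) * (monom 1 (2 * n) - 1)"
    by (simp add: mult_monom algebra_simps)
  also have "monom (1::int) (2 * n) - 1 = (\<Sum>s=1..n. of_nat (n choose s) * ?v ^ s)"
    unfolding exp by (simp add: atMost_atLeast0 sum.atLeast_Suc_atMost)
  also have "monom 1 (2 * c) * \<dots>
      = (\<Sum>i\<le>c. of_nat (c choose i) * (\<Sum>s=1..n. of_nat (n choose s) * ?v ^ (i + s)))"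
    unfolding exp sum_product by (simp add: sum_distrib_left power_add mult_ac)
  finally have "euler_functional a (monom 1 (2 * (n + c)) - monom 1 (2 * c)) = euler_functional a \<dots>"
    by simp
  then show ?thesis
    by (simp add: euler_functional_diff euler_functional_monom euler_functional_sum
        euler_functional_of_nat_mult even_euler_diff_def)
qed

text \<open>Induction along the recurrence: for \<open>i \<ge> 1\<close> the factor
  \<open>4 ^ i\<close> supplies exactly the \<open>2 * i\<close> twos missing from
  \<open>2 ^ (j - 2 * i)\<close>, which divides every difference in the inner sum.\<close>

lemma two_power_dvd_even_euler_diff: "2 ^ j dvd even_euler_diff a j"
proof (induction j rule: less_induct)
  case (less j)
  let ?t = "\<lambda>i. int (j choose (2 * i)) * (4 * a\<^sup>2) ^ i *
      (\<Sum>l\<le>i. int (i choose l) * even_euler_diff a (j - 2 * i + l))"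
  have "2 ^ j dvd ?t i" if i: "i \<in> {1..j div 2}" for i
  proof -
    have "2 ^ (j - 2 * i) dvd even_euler_diff a (j - 2 * i + l)" if "l \<le> i" for l
      by (rule power_le_dvd[OF less]) (use that i in auto)
    then have "4 ^ i * 2 ^ (j - 2 * i) dvd
        4 ^ i * (\<Sum>l\<le>i. int (i choose l) * even_euler_diff a (j - 2 * i + l))"
      by (intro mult_dvd_mono dvd_refl dvd_sum dvd_mult) auto
    also have "(4::int) ^ i * 2 ^ (j - 2 * i) = 2 ^ j"
    proof -
      have "(4::int) ^ i * 2 ^ (j - 2 * i) = 2 ^ (2 * i + (j - 2 * i))"
        by (simp add: power_add power_mult)
      then show ?thesis
        using i by (simp add: less_eq_div_iff_mult_less_eq)
    qed
    finally have "2 ^ j dvd (int (j choose (2 * i)) * (a\<^sup>2) ^ i) *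
        (4 ^ i * (\<Sum>l\<le>i. int (i choose l) * even_euler_diff a (j - 2 * i + l)))"
      by (rule dvd_mult)
    then show ?thesis
      by (simp add: power_mult_distrib mult_ac)
  qed
  then have S: "2 ^ j dvd (\<Sum>i=1..j div 2. ?t i)"
    by (rule dvd_sum)
  have eq: "even_euler_diff a j + (\<Sum>i=1..j div 2. ?t i) = (- 2 * a) ^ j"
  proof -
    have "even_euler_diff a j + (\<Sum>i=1..j div 2. ?t i) = ?t 0 + (\<Sum>i=1..j div 2. ?t i)"
      by simp
    also have "\<dots> = (\<Sum>i\<le>j div 2. ?t i)"
      by (simp only: atMost_atLeast0 sum.atLeast_Suc_atMost[OF le0] One_nat_def)
    also have "\<dots> = (- 2 * a) ^ j"
      by (rule even_euler_diff_recurrence)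
    finally show ?thesis .
  qed
  have "2 ^ j dvd even_euler_diff a j + (\<Sum>i=1..j div 2. ?t i)"
    unfolding eq by (intro dvd_power_same) simp
  with S show ?case
    by (simp only: dvd_add_left_iff)
qed

section \<open>Residues of the differences modulo \<open>2 ^ 14\<close> for odd
  \<open>a\<close>\<close>

lemma binomial_numeral:
  "numeral m choose numeral n = (pred_numeral m choose pred_numeral n) + (pred_numeral m choose numeral n)"
  by (simp add: numeral_eq_Suc)

text \<open>
  The modulus \<open>2\<^sup>1\<^sup>4\<close> is what the final modulus \<open>2\<^sup>1\<^sup>1 K\<close> requires here: for \<open>s < 16\<close> the binomial
  coefficient \<open>K choose s\<close> has at most three factors 2 less than \<open>K\<close>.
\<close>

lemma even_euler_diff_residues:
  fixes a x :: int
  assumes a2: "a\<^sup>2 = 1 + 8 * x"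
  shows "even_euler_diff a 1 = - 2 * a"
    and "even_euler_diff a 2 = a * (8 + 64 * x)"
    and "even_euler_diff a 3 = a * (- 80 - 1408 * x - 6144 * x\<^sup>2)"
    and "[even_euler_diff a 4 = a * (1664 - 5120 * x - 8192 * x\<^sup>2)] (mod 16384)"
    and "[even_euler_diff a 5 = a * (7424 + 6144 * x)] (mod 16384)"
    and "[even_euler_diff a 6 = a * (- 3072 - 8192 * x)] (mod 16384)"
    and "[even_euler_diff a 7 = a * 6144] (mod 16384)"
    and "j \<in> {8..13} \<Longrightarrow> 16384 dvd even_euler_diff a j"
proof -
  define g where "g = even_euler_diff a"
  define A where "A = 4 * a\<^sup>2"
  have A: "A = 4 + 32 * x"
    by (simp add: A_def a2)
  have A2: "A ^ 2 = 16 + 256 * x + 1024 * x\<^sup>2"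
    by (simp add: A eval_nat_numeral algebra_simps)
  have A3: "A ^ 3 = 64 + 1536 * x + 12288 * x\<^sup>2 + 16384 * (2 * x ^ 3)"
    by (simp add: A eval_nat_numeral algebra_simps)
  \<comment> \<open>From here on multiples of 16384 are hidden behind fresh integers, which keeps
    the later polynomial normalizations small.\<close>
  obtain t4 where A4: "A ^ 4 = 256 + 8192 * x + 16384 * t4"
  proof
    show "A ^ 4 = 256 + 8192 * x + 16384 * (6 * x\<^sup>2 + 32 * x ^ 3 + 64 * x ^ 4)"
      by (simp add: A eval_nat_numeral algebra_simps)
  qed
  obtain t5 where A5: "A ^ 5 = 1024 + 8192 * x + 16384 * t5"
  proof
    show "A ^ 5 = 1024 + 8192 * x
        + 16384 * (2 * x + 40 * x\<^sup>2 + 320 * x ^ 3 + 1280 * x ^ 4 + 2048 * x ^ 5)"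
      by (simp add: A eval_nat_numeral algebra_simps)
  qed
  obtain t6 where A6: "A ^ 6 = 4096 + 16384 * t6"
  proof
    show "A ^ 6 = 4096 + 16384 *
        (12 * x + 240 * x\<^sup>2 + 2560 * x ^ 3 + 15360 * x ^ 4 + 49152 * x ^ 5 + 65536 * x ^ 6)"
      by (simp add: A eval_nat_numeral algebra_simps)
  qed
  note A_powers = A2 A3 A4 A5 A6
  note unfold_sums = atMost_nat_numeral binomial_numeral numeral_2_eq_2 [symmetric] numeral_3_eq_3 [symmetric]
  note rec = even_euler_diff_recurrence[of _ a, folded A_def g_def]
  have even_power: "(- 2 * a) ^ (2 * n) = A ^ n"
    and odd_power: "(- 2 * a) ^ Suc (2 * n) = - 2 * a * A ^ n" for n
    by (simp_all add: power_mult power_mult_distrib A_def)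
  have g0: "g 0 = 1"
    using rec[of 0] by simp
  have g1: "g 1 = - 2 * a"
    using rec[of 1] by simp
  have g2: "g 2 = a * (8 + 64 * x)"
    using rec[of 2] even_power[of 1]
    by (simp add: unfold_sums g0 g1[simplified] A algebra_simps)
  have g3: "g 3 = a * (- 80 - 1408 * x - 6144 * x\<^sup>2)"
    using rec[of 3] odd_power[of 1]
    by (simp add: unfold_sums g0 g1[simplified] g2 A algebra_simps power2_eq_square)
  \<comment> \<open>The recurrence solved for its top term. For even indices the summand with
    \<open>g 0\<close> cancels the right-hand side, so up to multiples of 16384 each residue is
    \<open>a\<close> times a polynomial in \<open>x\<close>. Subtracting the claimed residue leaves
    monomials whose coefficients are all divisible by 16384.\<close>
  have r: "g 4 = A ^ 2 - (6 * A * (g 2 + g 3)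
        + A ^ 2 * (g 0 + 2 * g 1 + g 2))"
    using rec[of 4] even_power[of 2] by (simp add: unfold_sums add_ac)
  have d4: "16384 dvd g 4 - a * (1664 - 5120 * x - 8192 * x\<^sup>2)"
    unfolding r A_powers unfolding A g0 g1 g2 g3
    by (simp add: algebra_simps power2_eq_square; intro dvd_add dvd_diff; simp)
  then obtain h4 where g4: "g 4 = a * (1664 - 5120 * x - 8192 * x\<^sup>2) + 16384 * h4"
    by (auto elim!: dvdE simp: algebra_simps)
  have r: "g 5 = - 2 * a * A ^ 2 - (10 * A * (g 3 + g 4)
        + 5 * A ^ 2 * (g 1 + 2 * g 2 + g 3))"
    using rec[of 5] odd_power[of 2] by (simp add: unfold_sums add_ac)
  have d5: "16384 dvd g 5 - a * (7424 + 6144 * x)"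
    unfolding r A_powers unfolding A g0 g1 g2 g3 g4
    by (simp add: algebra_simps power2_eq_square; intro dvd_add dvd_diff; simp)
  then obtain h5 where g5: "g 5 = a * (7424 + 6144 * x) + 16384 * h5"
    by (auto elim!: dvdE simp: algebra_simps)
  have r: "g 6 = A ^ 3 - (15 * A * (g 4 + g 5)
        + 15 * A ^ 2 * (g 2 + 2 * g 3 + g 4)
        + A ^ 3 * (g 0 + 3 * g 1 + 3 * g 2 + g 3))"
    using rec[of 6] even_power[of 3] by (simp add: unfold_sums add_ac)
  have d6: "16384 dvd g 6 - a * (- 3072 - 8192 * x)"
    unfolding r A_powers unfolding A g0 g1 g2 g3 g4 g5
    by (simp add: algebra_simps power2_eq_square; intro dvd_add dvd_diff; simp)
  then obtain h6 where g6: "g 6 = a * (- 3072 - 8192 * x) + 16384 * h6"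
    by (auto elim!: dvdE simp: algebra_simps)
  have r: "g 7 = - 2 * a * A ^ 3 - (21 * A * (g 5 + g 6)
        + 35 * A ^ 2 * (g 3 + 2 * g 4 + g 5)
        + 7 * A ^ 3 * (g 1 + 3 * g 2 + 3 * g 3 + g 4))"
    using rec[of 7] odd_power[of 3] by (simp add: unfold_sums add_ac)
  have d7: "16384 dvd g 7 - a * 6144"
    unfolding r A_powers unfolding A g0 g1 g2 g3 g4 g5 g6
    by (simp add: algebra_simps power2_eq_square; intro dvd_add dvd_diff; simp)
  then obtain h7 where g7: "g 7 = a * 6144 + 16384 * h7"
    by (auto elim!: dvdE simp: algebra_simps)
  have r: "g 8 = A ^ 4 - (28 * A * (g 6 + g 7)
        + 70 * A ^ 2 * (g 4 + 2 * g 5 + g 6)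
        + 28 * A ^ 3 * (g 2 + 3 * g 3 + 3 * g 4 + g 5)
        + A ^ 4 * (g 0 + 4 * g 1 + 6 * g 2 + 4 * g 3 + g 4))"
    using rec[of 8] even_power[of 4] by (simp add: unfold_sums add_ac)
  \<comment> \<open>The residues are 0 from here on. The computation ends at 13 because
    \<open>2 ^ j\<close> already supplies \<open>2 ^ 14\<close> for
    \<open>j \<ge> 14\<close>.\<close>
  have d8: "16384 dvd g 8"
    unfolding r A_powers unfolding A g0 g1 g2 g3 g4 g5 g6 g7
    by (simp add: algebra_simps power2_eq_square; intro dvd_add dvd_diff; simp)
  then obtain h8 where g8: "g 8 = 16384 * h8"
    by (auto elim!: dvdE simp: algebra_simps)
  have r: "g 9 = - 2 * a * A ^ 4 - (36 * A * (g 7 + g 8)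
        + 126 * A ^ 2 * (g 5 + 2 * g 6 + g 7)
        + 84 * A ^ 3 * (g 3 + 3 * g 4 + 3 * g 5 + g 6)
        + 9 * A ^ 4 * (g 1 + 4 * g 2 + 6 * g 3 + 4 * g 4 + g 5))"
    using rec[of 9] odd_power[of 4] by (simp add: unfold_sums add_ac)
  have d9: "16384 dvd g 9"
    unfolding r A_powers unfolding A g0 g1 g2 g3 g4 g5 g6 g7 g8
    by (simp add: algebra_simps power2_eq_square; intro dvd_add dvd_diff; simp)
  then obtain h9 where g9: "g 9 = 16384 * h9"
    by (auto elim!: dvdE simp: algebra_simps)
  have r: "g 10 = A ^ 5 - (45 * A * (g 8 + g 9)
        + 210 * A ^ 2 * (g 6 + 2 * g 7 + g 8)
        + 210 * A ^ 3 * (g 4 + 3 * g 5 + 3 * g 6 + g 7)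
        + 45 * A ^ 4 * (g 2 + 4 * g 3 + 6 * g 4 + 4 * g 5 + g 6)
        + A ^ 5 * (g 0 + 5 * g 1 + 10 * g 2 + 10 * g 3 + 5 * g 4 + g 5))"
    using rec[of 10] even_power[of 5] by (simp add: unfold_sums add_ac)
  have d10: "16384 dvd g 10"
    unfolding r A_powers unfolding A g0 g1 g2 g3 g4 g5 g6 g7 g8 g9
    by (simp add: algebra_simps power2_eq_square; intro dvd_add dvd_diff; simp)
  then obtain h10 where g10: "g 10 = 16384 * h10"
    by (auto elim!: dvdE simp: algebra_simps)
  have r: "g 11 = - 2 * a * A ^ 5 - (55 * A * (g 9 + g 10)
        + 330 * A ^ 2 * (g 7 + 2 * g 8 + g 9)
        + 462 * A ^ 3 * (g 5 + 3 * g 6 + 3 * g 7 + g 8)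
        + 165 * A ^ 4 * (g 3 + 4 * g 4 + 6 * g 5 + 4 * g 6 + g 7)
        + 11 * A ^ 5 * (g 1 + 5 * g 2 + 10 * g 3 + 10 * g 4 + 5 * g 5 + g 6))"
    using rec[of 11] odd_power[of 5] by (simp add: unfold_sums add_ac)
  have d11: "16384 dvd g 11"
    unfolding r A_powers unfolding A g0 g1 g2 g3 g4 g5 g6 g7 g8 g9 g10
    by (simp add: algebra_simps power2_eq_square; intro dvd_add dvd_diff; simp)
  then obtain h11 where g11: "g 11 = 16384 * h11"
    by (auto elim!: dvdE simp: algebra_simps)
  have r: "g 12 = A ^ 6 - (66 * A * (g 10 + g 11)
        + 495 * A ^ 2 * (g 8 + 2 * g 9 + g 10)
        + 924 * A ^ 3 * (g 6 + 3 * g 7 + 3 * g 8 + g 9)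
        + 495 * A ^ 4 * (g 4 + 4 * g 5 + 6 * g 6 + 4 * g 7 + g 8)
        + 66 * A ^ 5 * (g 2 + 5 * g 3 + 10 * g 4 + 10 * g 5 + 5 * g 6 + g 7)
        + A ^ 6 * (g 0 + 6 * g 1 + 15 * g 2 + 20 * g 3 + 15 * g 4 + 6 * g 5 + g 6))"
    using rec[of 12] even_power[of 6] by (simp add: unfold_sums add_ac)
  have d12: "16384 dvd g 12"
    unfolding r A_powers unfolding A g0 g1 g2 g3 g4 g5 g6 g7 g8 g9 g10 g11
    by (simp add: algebra_simps power2_eq_square; intro dvd_add dvd_diff; simp)
  then obtain h12 where g12: "g 12 = 16384 * h12"
    by (auto elim!: dvdE simp: algebra_simps)
  have r: "g 13 = - 2 * a * A ^ 6 - (78 * A * (g 11 + g 12)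
        + 715 * A ^ 2 * (g 9 + 2 * g 10 + g 11)
        + 1716 * A ^ 3 * (g 7 + 3 * g 8 + 3 * g 9 + g 10)
        + 1287 * A ^ 4 * (g 5 + 4 * g 6 + 6 * g 7 + 4 * g 8 + g 9)
        + 286 * A ^ 5 * (g 3 + 5 * g 4 + 10 * g 5 + 10 * g 6 + 5 * g 7 + g 8)
        + 13 * A ^ 6 * (g 1 + 6 * g 2 + 15 * g 3 + 20 * g 4 + 15 * g 5 + 6 * g 6 + g 7))"
    using rec[of 13] odd_power[of 6] by (simp add: unfold_sums add_ac)
  have d13: "16384 dvd g 13"
    unfolding r A_powers unfolding A g0 g1 g2 g3 g4 g5 g6 g7 g8 g9 g10 g11 g12
    by (simp add: algebra_simps power2_eq_square; intro dvd_add dvd_diff; simp)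
  show "even_euler_diff a 1 = - 2 * a"
    and "even_euler_diff a 2 = a * (8 + 64 * x)"
    and "even_euler_diff a 3 = a * (- 80 - 1408 * x - 6144 * x\<^sup>2)"
    using g1 g2 g3 by (simp_all only: g_def)
  show "[even_euler_diff a 4 = a * (1664 - 5120 * x - 8192 * x\<^sup>2)] (mod 16384)"
    and "[even_euler_diff a 5 = a * (7424 + 6144 * x)] (mod 16384)"
    and "[even_euler_diff a 6 = a * (- 3072 - 8192 * x)] (mod 16384)"
    and "[even_euler_diff a 7 = a * 6144] (mod 16384)"
    using d4 d5 d6 d7 by (simp_all only: g_def cong_iff_dvd_diff)
  show "16384 dvd even_euler_diff a j" if "j \<in> {8..13}"
  proof -
    from that have "j = 8 \<or> j = 9 \<or> j = 10 \<or> j = 11 \<or> j = 12 \<or> j = 13"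
      by auto
    then show ?thesis
      using d8 d9 d10 d11 d12 d13 by (auto simp: g_def)
  qed
qed

section \<open>Divisibility of the summands of high index\<close>

lemma odd_square_eq:
  fixes a :: int
  assumes "odd a"
  obtains x where "a\<^sup>2 = 1 + 8 * x"
proof -
  obtain d where d: "a = 2 * d + 1"
    using assms by (elim oddE)
  have "even (d * (d + 1))"
    by simp
  then obtain x where "d * (d + 1) = 2 * x"
    by (elim evenE)
  then have "a\<^sup>2 = 1 + 8 * x"
    by (simp add: d power2_eq_square algebra_simps)
  then show ?thesis
    by (rule that)
qed

text \<open>Here \<open>2 ^ e\<close> stands for the 2-part of the lower binomial index, whose loss
  has to be made up for. For \<open>j \<le> 13\<close> this forces \<open>e \<le> 3\<close>, so
  \<open>2 ^ 14\<close> suffices; for \<open>j \<ge> 14\<close> the general bound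
  \<open>2 ^ j\<close> does, since \<open>11 + e \<le> j\<close>.\<close>

lemma two_power_dvd_even_euler_diff_ge_8:
  assumes "odd a" and j: "j \<ge> 8" and e: "2 ^ e \<le> j"
  shows "2 ^ (11 + e) dvd even_euler_diff a j"
proof (cases "j \<le> 13")
  case True
  obtain x where "a\<^sup>2 = 1 + 8 * x"
    using \<open>odd a\<close> by (rule odd_square_eq)
  from even_euler_diff_residues(8)[OF this, of j] True j
  have "2 ^ 14 dvd even_euler_diff a j"
    by simp
  moreover have "(2::nat) ^ e < 2 ^ 4"
    using e True by simp
  then have "11 + e \<le> 14"
    by (subst (asm) power_strict_increasing_iff) auto
  ultimately show ?thesis
    by (rule power_le_dvd)
next
  case False
  have "11 + e \<le> j"
  proof (cases "e \<le> 3")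
    case False
    then have "4 \<le> e"
      by simp
    then have "11 + e \<le> 2 ^ e"
      by (induction e rule: dec_induct) auto
    with e show ?thesis
      by simp
  qed (use \<open>\<not> j \<le> 13\<close> in simp)
  with two_power_dvd_even_euler_diff show ?thesis
    by (rule power_le_dvd)
qed

text \<open>The identity \<open>s (K choose s) = K (K - 1 choose s - 1)\<close> loses the 2-part of \<open>s\<close>.\<close>

lemma two_power_dvd_binomial_mult_even_euler_diff:
  assumes "odd a" and "j \<ge> 8" and s: "s \<ge> 1" "s \<le> j" and K: "2 ^ n dvd K"
  shows "2 ^ (n + 11) dvd int (K choose s) * even_euler_diff a j"
proof -
  obtain r where r: "s = 2 ^ multiplicity 2 s * r" "odd r"
    using s multiplicity_decompose'[of s 2] by auto
  define e where "e = multiplicity 2 s"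
  have "2 ^ e \<le> s"
    using r s by (simp add: e_def dvd_imp_le multiplicity_dvd)
  then have "2 ^ (11 + e) dvd even_euler_diff a j"
    using assms by (intro two_power_dvd_even_euler_diff_ge_8) auto
  moreover have "2 ^ n dvd int K"
    using K by (metis of_nat_dvd_iff of_nat_numeral of_nat_power)
  \<comment> \<open>The surplus \<open>2 ^ e\<close> pays for the 2-part of \<open>s\<close> after
    absorption; the odd part \<open>r\<close> is then removed by coprimality.\<close>
  ultimately have "2 ^ n * 2 ^ (11 + e) dvd int K * int ((K - 1) choose (s - 1)) * even_euler_diff a j"
    by (intro mult_dvd_mono dvd_mult2)
  also have "int K * int ((K - 1) choose (s - 1)) = int s * int (K choose s)"
    using s times_binomial_minus1_eq[of s K] by (simp flip: of_nat_mult)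
  also have "int s = 2 ^ e * int r"
    using r(1) unfolding e_def by (metis of_nat_mult of_nat_numeral of_nat_power)
  finally have "2 ^ e * 2 ^ (n + 11) dvd 2 ^ e * (int r * (int (K choose s) * even_euler_diff a j))"
    by (simp add: power_add mult_ac)
  then have "2 ^ (n + 11) dvd int r * (int (K choose s) * even_euler_diff a j)"
    by (subst (asm) dvd_mult_cancel_left) simp
  moreover have "coprime (2 ^ (n + 11)) (int r)"
    using r(2) by simp
  ultimately show ?thesis
    by (simp add: coprime_dvd_mult_right_iff)
qed

section \<open>Explicit binomial coefficients and comparison of Newton coefficients\<close>

lemma binomial_Suc_mult:
  "int (Suc s) * int (n choose Suc s) = (int n - int s) * int (n choose s)"
proof (cases "s \<le> n")
  case True
  have "Suc s * (n choose Suc s) = (n - s) * (n choose s)"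
    using binomial_absorption[of s n] binomial_absorb_comp[of n s] by simp
  with True show ?thesis
    by (metis of_nat_diff of_nat_mult)
qed (simp add: binomial_eq_0)

text \<open>315 is the odd part of \<open>7!\<close>. The 2-part of \<open>s!\<close> is absorbed by
  the twos in \<open>16 y\<close>, \<open>16 y - 2 = 2 (8 y - 1)\<close>,
  \<open>16 y - 4 = 4 (4 y - 1)\<close> and \<open>16 y - 6 = 2 (8 y - 3)\<close>, so a polynomial
  cofactor of \<open>y\<close> with integer coefficients remains.\<close>

lemma binomial_16_mult:
  fixes y :: nat
  defines "Y \<equiv> int y" and "B \<equiv> \<lambda>s. 315 * int ((16 * y) choose s)"
  shows "B 1 = Y * 5040"
    and "B 2 = Y * (2520 * (16 * Y - 1))"
    and "B 3 = Y * (1680 * (16 * Y - 1) * (8 * Y - 1))"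
    and "B 4 = Y * (420 * (16 * Y - 1) * (8 * Y - 1) * (16 * Y - 3))"
    and "B 5 = Y * (336 * (16 * Y - 1) * (8 * Y - 1) * (16 * Y - 3) * (4 * Y - 1))"
    and "B 6 = Y * (56 * (16 * Y - 1) * (8 * Y - 1) * (16 * Y - 3) * (4 * Y - 1) * (16 * Y - 5))"
    and "B 7 = Y * (16 * (16 * Y - 1) * (8 * Y - 1) * (16 * Y - 3) * (4 * Y - 1)
          * (16 * Y - 5) * (8 * Y - 3))"
proof -
  have step: "int (Suc s) * B (Suc s) = (16 * Y - int s) * B s" for s
    using binomial_Suc_mult[of s "16 * y"] by (simp add: B_def Y_def)
  show 1: "B 1 = Y * 5040"
    by (simp add: B_def Y_def)
  show 2: "B 2 = Y * (2520 * (16 * Y - 1))"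
    using step[of 1] by (simp add: numeral_2_eq_2 1[simplified] algebra_simps)
  show 3: "B 3 = Y * (1680 * (16 * Y - 1) * (8 * Y - 1))"
    using step[of 2] by (simp add: 2 algebra_simps)
  show 4: "B 4 = Y * (420 * (16 * Y - 1) * (8 * Y - 1) * (16 * Y - 3))"
    using step[of 3] by (simp add: 3 algebra_simps)
  show 5: "B 5 = Y * (336 * (16 * Y - 1) * (8 * Y - 1) * (16 * Y - 3) * (4 * Y - 1))"
    using step[of 4] by (simp add: 4 algebra_simps)
  show 6: "B 6 = Y * (56 * (16 * Y - 1) * (8 * Y - 1) * (16 * Y - 3) * (4 * Y - 1) * (16 * Y - 5))"
    using step[of 5] by (simp add: 5 algebra_simps)
  show "B 7 = Y * (16 * (16 * Y - 1) * (8 * Y - 1) * (16 * Y - 3) * (4 * Y - 1)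
          * (16 * Y - 5) * (8 * Y - 3))"
    using step[of 6] by (simp add: 6 algebra_simps)
qed

text \<open>The coefficient of \<open>C i\<close> in the \<open>n\<close>-th power is
  \<open>i!\<close> times a Stirling number of the second kind. The expansions follow one from
  another by \<open>c * C i = i * C i + (i + 1) * C (i + 1)\<close>.\<close>

lemma power_newton_expansion:
  fixes c :: nat
  defines "C \<equiv> \<lambda>i. int (c choose i)"
  shows "int c = C 1"
    and "int c ^ 2 = C 1 + 2 * C 2"
    and "int c ^ 3 = C 1 + 6 * C 2 + 6 * C 3"
    and "int c ^ 4 = C 1 + 14 * C 2 + 36 * C 3 + 24 * C 4"
    and "int c ^ 5 = C 1 + 30 * C 2 + 150 * C 3 + 240 * C 4 + 120 * C 5"
    and "int c ^ 6 = C 1 + 62 * C 2 + 540 * C 3 + 1560 * C 4 + 1800 * C 5 + 720 * C 6"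
proof -
  have step: "int c * C i = int i * C i + int (Suc i) * C (Suc i)" for i
    using binomial_Suc_mult[of i c] by (simp add: C_def algebra_simps)
  have steps: "int c * C 1 = C 1 + 2 * C 2" "int c * C 2 = 2 * C 2 + 3 * C 3"
    "int c * C 3 = 3 * C 3 + 4 * C 4" "int c * C 4 = 4 * C 4 + 5 * C 5"
    "int c * C 5 = 5 * C 5 + 6 * C 6"
    using step[of 1] step[of 2] step[of 3] step[of 4] step[of 5]
    by (simp_all add: eval_nat_numeral)
  show 1: "int c = C 1"
    by (simp add: C_def)
  have Suc: "int c ^ Suc n = int c * int c ^ n" for n
    by simp
  show 2: "int c ^ 2 = C 1 + 2 * C 2"
    using steps(1) by (simp add: power2_eq_square 1)
  show 3: "int c ^ 3 = C 1 + 6 * C 2 + 6 * C 3"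
    using Suc[of 2] steps by (simp add: 2 algebra_simps)
  show 4: "int c ^ 4 = C 1 + 14 * C 2 + 36 * C 3 + 24 * C 4"
    using Suc[of 3] steps by (simp add: 3 algebra_simps)
  show 5: "int c ^ 5 = C 1 + 30 * C 2 + 150 * C 3 + 240 * C 4 + 120 * C 5"
    using Suc[of 4] steps by (simp add: 4 algebra_simps)
  show "int c ^ 6 = C 1 + 62 * C 2 + 540 * C 3 + 1560 * C 4 + 1800 * C 5 + 720 * C 6"
    using Suc[of 5] steps by (simp add: 5 algebra_simps)
qed

text \<open>
  The right-hand sides are the Newton coefficients, in \<open>c\<close>, of \<open>M (q0 + q1 b + \<dots> + q6 b^6)\<close>
  at \<open>b = 2 c\<close>. Multiplying by 315 clears the odd denominators of \<open>16 y choose s\<close>. With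
  \<open>a\<^sup>2 = 1 + 8 x\<close> the difference of the two sides is then \<open>y\<close> times a polynomial in \<open>a\<close>, \<open>x\<close>, \<open>y\<close>
  that is, coefficient by coefficient, \<open>0\<close> modulo \<open>2\<^sup>1\<^sup>5\<close> and \<open>2\<^sup>1\<^sup>4 (a + 1)\<close>.
\<close>

lemma truncated_sum_cong:
  fixes a :: int and k n y :: nat
  assumes "odd a" and y: "y = 2 ^ n * k"
  defines "M \<equiv> 32 * int y"
  defines "q0 \<equiv> 70 * a ^ 3 + 64 * a\<^sup>2 - 81 * a + 448 + M * (16 - a ^ 3)"
    and "q1 \<equiv> 38 * a ^ 3 - 8 * a - 256 + M * (a ^ 3 + 2 * a)"
    and "q2 \<equiv> - (6 * a ^ 4 + 35 * a ^ 3 - 12 * a\<^sup>2 + 106 * a - 122) + 2 * M * a"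
    and "q3 \<equiv> 4 * a ^ 3 + 56 * a + 2 * M"
    and "q4 \<equiv> 3 * a ^ 3 - 14 * a + M"
    and "q5 \<equiv> - 6 * a"
    and "q6 \<equiv> 7 * a"
  shows "[(\<Sum>s=1..7 - 0. int ((16 * y) choose s) * even_euler_diff a (0 + s))
      = M * q0] (mod 2 ^ (n + 15))"
    and "[(\<Sum>s=1..7 - 1. int ((16 * y) choose s) * even_euler_diff a (1 + s))
      = M * (2 * q1 + 4 * q2 + 8 * q3 + 16 * q4 + 32 * q5 + 64 * q6)] (mod 2 ^ (n + 15))"
    and "[(\<Sum>s=1..7 - 2. int ((16 * y) choose s) * even_euler_diff a (2 + s))
      = M * (8 * q2 + 48 * q3 + 224 * q4 + 960 * q5 + 3968 * q6)] (mod 2 ^ (n + 15))"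
    and "[(\<Sum>s=1..7 - 3. int ((16 * y) choose s) * even_euler_diff a (3 + s))
      = M * (48 * q3 + 576 * q4 + 4800 * q5 + 34560 * q6)] (mod 2 ^ (n + 15))"
    and "[(\<Sum>s=1..7 - 4. int ((16 * y) choose s) * even_euler_diff a (4 + s))
      = M * (384 * q4 + 7680 * q5 + 99840 * q6)] (mod 2 ^ (n + 15))"
    and "[(\<Sum>s=1..7 - 5. int ((16 * y) choose s) * even_euler_diff a (5 + s))
      = M * (3840 * q5 + 115200 * q6)] (mod 2 ^ (n + 15))"
    and "[(\<Sum>s=1..7 - 6. int ((16 * y) choose s) * even_euler_diff a (6 + s))
      = M * (46080 * q6)] (mod 2 ^ (n + 15))"
proof -
  define Y where "Y = int y"
  define g where "g = even_euler_diff a"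
  define B where "B s = int ((16 * y) choose s)" for s
  obtain x where a2: "a\<^sup>2 = 1 + 8 * x"
    using \<open>odd a\<close> by (rule odd_square_eq)
  have a3: "a ^ 3 = a * (1 + 8 * x)"
    using a2 by (simp add: power3_eq_cube power2_eq_square)
  have a4: "a ^ 4 = (1 + 8 * x) * (1 + 8 * x)"
    by (simp add: power4_eq_xxxx power2_eq_square flip: a2)
  \<comment> \<open>Writing \<open>a + 1\<close> as \<open>2 * e\<close> turns multiples of
    \<open>2 ^ 14 * (a + 1)\<close> into visible multiples of \<open>2 ^ 15\<close>.\<close>
  obtain e where ae: "a = 2 * e - 1"
    using \<open>odd a\<close> by (metis add_diff_cancel_right' evenE odd_even_add odd_one)
  note residues = even_euler_diff_residues[OF a2, folded g_def]
  \<comment> \<open>Residues modulo \<open>2 ^ 14\<close> suffice for a comparison modulo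
    \<open>2 ^ 15\<close>: every cofactor of \<open>Y\<close> in \<open>binomial_16_mult\<close> is
    a multiple of 4, so the unknown parts \<open>h4\<close> to \<open>h7\<close> drop out.\<close>
  obtain h4 where g4: "g 4 = a * (1664 - 5120 * x - 8192 * x\<^sup>2) + 16384 * h4"
    using residues(4) by (auto simp: cong_iff_dvd_diff algebra_simps elim!: dvdE)
  obtain h5 where g5: "g 5 = a * (7424 + 6144 * x) + 16384 * h5"
    using residues(5) by (auto simp: cong_iff_dvd_diff algebra_simps elim!: dvdE)
  obtain h6 where g6: "g 6 = a * (- 3072 - 8192 * x) + 16384 * h6"
    using residues(6) by (auto simp: cong_iff_dvd_diff algebra_simps elim!: dvdE)
  obtain h7 where g7: "g 7 = a * 6144 + 16384 * h7"
    using residues(7) by (auto simp: cong_iff_dvd_diff algebra_simps elim!: dvdE)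
  note g_values = residues(1,2,3) g4 g5 g6 g7
  note q_defs = q0_def q1_def q2_def q3_def q4_def q5_def q6_def
  note B_values = binomial_16_mult[of y, folded Y_def, folded B_def]
  have M: "M = 32 * Y"
    by (simp add: M_def Y_def)
  \<comment> \<open>\<open>2 ^ n\<close> comes from \<open>Y\<close> and \<open>2 ^ 15\<close> from
    its cofactor; \<open>10080 = 315 * 32\<close> because \<open>M = 32 * Y\<close>. The odd factor
    315 cancels.\<close>
  have cancel: "[t = M * r] (mod 2 ^ (n + 15))"
    if t: "315 * t = Y * p" and d: "32768 dvd p - 10080 * r" for t r p
  proof -
    have "2 ^ n dvd Y"
      by (simp add: Y_def y)
    then have "2 ^ n * 2 ^ 15 dvd Y * (p - 10080 * r)"
      using d by (intro mult_dvd_mono) auto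
    also have "Y * (p - 10080 * r) = 315 * (t - M * r)"
      using t by (simp add: M algebra_simps)
    finally have "2 ^ (n + 15) dvd 315 * (t - M * r)"
      by (simp add: power_add)
    moreover have "coprime (2 ^ (n + 15)) (315 :: int)"
      by simp
    ultimately show ?thesis
      by (simp only: cong_iff_dvd_diff coprime_dvd_mult_right_iff)
  qed
  \<comment> \<open>The seven sums follow one pattern: extract \<open>Y\<close>, check the cofactor
    modulo \<open>2 ^ 15\<close>, apply \<open>cancel\<close>.\<close>
  have "315 * (B 1 * g 1 + B 2 * g 2 + B 3 * g 3 + B 4 * g 4 + B 5 * g 5 + B 6 * g 6 + B 7 * g 7)
      = Y * (5040 * g 1
        + (2520 * (16 * Y - 1)) * g 2
        + (1680 * (16 * Y - 1) * (8 * Y - 1)) * g 3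
        + (420 * (16 * Y - 1) * (8 * Y - 1) * (16 * Y - 3)) * g 4
        + (336 * (16 * Y - 1) * (8 * Y - 1) * (16 * Y - 3) * (4 * Y - 1)) * g 5
        + (56 * (16 * Y - 1) * (8 * Y - 1) * (16 * Y - 3) * (4 * Y - 1) * (16 * Y - 5)) * g 6
        + (16 * (16 * Y - 1) * (8 * Y - 1) * (16 * Y - 3) * (4 * Y - 1)
          * (16 * Y - 5) * (8 * Y - 3)) * g 7)"
    using B_values by (simp only: distrib_left mult.assoc[symmetric])
  moreover have "32768 dvd 5040 * g 1
        + (2520 * (16 * Y - 1)) * g 2
        + (1680 * (16 * Y - 1) * (8 * Y - 1)) * g 3
        + (420 * (16 * Y - 1) * (8 * Y - 1) * (16 * Y - 3)) * g 4
        + (336 * (16 * Y - 1) * (8 * Y - 1) * (16 * Y - 3) * (4 * Y - 1)) * g 5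
        + (56 * (16 * Y - 1) * (8 * Y - 1) * (16 * Y - 3) * (4 * Y - 1) * (16 * Y - 5)) * g 6
        + (16 * (16 * Y - 1) * (8 * Y - 1) * (16 * Y - 3) * (4 * Y - 1)
          * (16 * Y - 5) * (8 * Y - 3)) * g 7
      - 10080 * q0"
    unfolding q_defs M a3 a4 a2 g_values unfolding ae
    by (simp add: algebra_simps power2_eq_square; intro dvd_add dvd_diff; simp)
  ultimately have "[B 1 * g 1 + B 2 * g 2 + B 3 * g 3 + B 4 * g 4 + B 5 * g 5 + B 6 * g 6 + B 7 * g 7
      = M * q0] (mod 2 ^ (n + 15))"
    by (rule cancel)
  then show "[(\<Sum>s=1..7 - 0. int ((16 * y) choose s) * even_euler_diff a (0 + s))
      = M * q0] (mod 2 ^ (n + 15))"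
    by (simp add: eval_nat_numeral g_def B_def)
  have "315 * (B 1 * g 2 + B 2 * g 3 + B 3 * g 4 + B 4 * g 5 + B 5 * g 6 + B 6 * g 7)
      = Y * (5040 * g 2
        + (2520 * (16 * Y - 1)) * g 3
        + (1680 * (16 * Y - 1) * (8 * Y - 1)) * g 4
        + (420 * (16 * Y - 1) * (8 * Y - 1) * (16 * Y - 3)) * g 5
        + (336 * (16 * Y - 1) * (8 * Y - 1) * (16 * Y - 3) * (4 * Y - 1)) * g 6
        + (56 * (16 * Y - 1) * (8 * Y - 1) * (16 * Y - 3) * (4 * Y - 1) * (16 * Y - 5)) * g 7)"
    using B_values by (simp only: distrib_left mult.assoc[symmetric])
  moreover have "32768 dvd 5040 * g 2
        + (2520 * (16 * Y - 1)) * g 3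
        + (1680 * (16 * Y - 1) * (8 * Y - 1)) * g 4
        + (420 * (16 * Y - 1) * (8 * Y - 1) * (16 * Y - 3)) * g 5
        + (336 * (16 * Y - 1) * (8 * Y - 1) * (16 * Y - 3) * (4 * Y - 1)) * g 6
        + (56 * (16 * Y - 1) * (8 * Y - 1) * (16 * Y - 3) * (4 * Y - 1) * (16 * Y - 5)) * g 7
      - 10080 * (2 * q1 + 4 * q2 + 8 * q3 + 16 * q4 + 32 * q5 + 64 * q6)"
    unfolding q_defs M a3 a4 a2 g_values unfolding ae
    by (simp add: algebra_simps power2_eq_square; intro dvd_add dvd_diff; simp)
  ultimately have "[B 1 * g 2 + B 2 * g 3 + B 3 * g 4 + B 4 * g 5 + B 5 * g 6 + B 6 * g 7
      = M * (2 * q1 + 4 * q2 + 8 * q3 + 16 * q4 + 32 * q5 + 64 * q6)] (mod 2 ^ (n + 15))"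
    by (rule cancel)
  then show "[(\<Sum>s=1..7 - 1. int ((16 * y) choose s) * even_euler_diff a (1 + s))
      = M * (2 * q1 + 4 * q2 + 8 * q3 + 16 * q4 + 32 * q5 + 64 * q6)] (mod 2 ^ (n + 15))"
    by (simp add: eval_nat_numeral g_def B_def)
  have "315 * (B 1 * g 3 + B 2 * g 4 + B 3 * g 5 + B 4 * g 6 + B 5 * g 7)
      = Y * (5040 * g 3
        + (2520 * (16 * Y - 1)) * g 4
        + (1680 * (16 * Y - 1) * (8 * Y - 1)) * g 5
        + (420 * (16 * Y - 1) * (8 * Y - 1) * (16 * Y - 3)) * g 6
        + (336 * (16 * Y - 1) * (8 * Y - 1) * (16 * Y - 3) * (4 * Y - 1)) * g 7)"
    using B_values by (simp only: distrib_left mult.assoc[symmetric])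
  moreover have "32768 dvd 5040 * g 3
        + (2520 * (16 * Y - 1)) * g 4
        + (1680 * (16 * Y - 1) * (8 * Y - 1)) * g 5
        + (420 * (16 * Y - 1) * (8 * Y - 1) * (16 * Y - 3)) * g 6
        + (336 * (16 * Y - 1) * (8 * Y - 1) * (16 * Y - 3) * (4 * Y - 1)) * g 7
      - 10080 * (8 * q2 + 48 * q3 + 224 * q4 + 960 * q5 + 3968 * q6)"
    unfolding q_defs M a3 a4 a2 g_values unfolding ae
    by (simp add: algebra_simps power2_eq_square; intro dvd_add dvd_diff; simp)
  ultimately have "[B 1 * g 3 + B 2 * g 4 + B 3 * g 5 + B 4 * g 6 + B 5 * g 7
      = M * (8 * q2 + 48 * q3 + 224 * q4 + 960 * q5 + 3968 * q6)] (mod 2 ^ (n + 15))"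
    by (rule cancel)
  then show "[(\<Sum>s=1..7 - 2. int ((16 * y) choose s) * even_euler_diff a (2 + s))
      = M * (8 * q2 + 48 * q3 + 224 * q4 + 960 * q5 + 3968 * q6)] (mod 2 ^ (n + 15))"
    by (simp add: eval_nat_numeral g_def B_def)
  have "315 * (B 1 * g 4 + B 2 * g 5 + B 3 * g 6 + B 4 * g 7)
      = Y * (5040 * g 4
        + (2520 * (16 * Y - 1)) * g 5
        + (1680 * (16 * Y - 1) * (8 * Y - 1)) * g 6
        + (420 * (16 * Y - 1) * (8 * Y - 1) * (16 * Y - 3)) * g 7)"
    using B_values by (simp only: distrib_left mult.assoc[symmetric])
  moreover have "32768 dvd 5040 * g 4
        + (2520 * (16 * Y - 1)) * g 5
        + (1680 * (16 * Y - 1) * (8 * Y - 1)) * g 6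
        + (420 * (16 * Y - 1) * (8 * Y - 1) * (16 * Y - 3)) * g 7
      - 10080 * (48 * q3 + 576 * q4 + 4800 * q5 + 34560 * q6)"
    unfolding q_defs M a3 a4 a2 g_values unfolding ae
    by (simp add: algebra_simps power2_eq_square; intro dvd_add dvd_diff; simp)
  ultimately have "[B 1 * g 4 + B 2 * g 5 + B 3 * g 6 + B 4 * g 7
      = M * (48 * q3 + 576 * q4 + 4800 * q5 + 34560 * q6)] (mod 2 ^ (n + 15))"
    by (rule cancel)
  then show "[(\<Sum>s=1..7 - 3. int ((16 * y) choose s) * even_euler_diff a (3 + s))
      = M * (48 * q3 + 576 * q4 + 4800 * q5 + 34560 * q6)] (mod 2 ^ (n + 15))"
    by (simp add: eval_nat_numeral g_def B_def)
  have "315 * (B 1 * g 5 + B 2 * g 6 + B 3 * g 7)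
      = Y * (5040 * g 5
        + (2520 * (16 * Y - 1)) * g 6
        + (1680 * (16 * Y - 1) * (8 * Y - 1)) * g 7)"
    using B_values by (simp only: distrib_left mult.assoc[symmetric])
  moreover have "32768 dvd 5040 * g 5
        + (2520 * (16 * Y - 1)) * g 6
        + (1680 * (16 * Y - 1) * (8 * Y - 1)) * g 7
      - 10080 * (384 * q4 + 7680 * q5 + 99840 * q6)"
    unfolding q_defs M a3 a4 a2 g_values unfolding ae
    by (simp add: algebra_simps power2_eq_square; intro dvd_add dvd_diff; simp)
  ultimately have "[B 1 * g 5 + B 2 * g 6 + B 3 * g 7
      = M * (384 * q4 + 7680 * q5 + 99840 * q6)] (mod 2 ^ (n + 15))"
    by (rule cancel)
  then show "[(\<Sum>s=1..7 - 4. int ((16 * y) choose s) * even_euler_diff a (4 + s))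
      = M * (384 * q4 + 7680 * q5 + 99840 * q6)] (mod 2 ^ (n + 15))"
    by (simp add: eval_nat_numeral g_def B_def)
  have "315 * (B 1 * g 6 + B 2 * g 7)
      = Y * (5040 * g 6
        + (2520 * (16 * Y - 1)) * g 7)"
    using B_values by (simp only: distrib_left mult.assoc[symmetric])
  moreover have "32768 dvd 5040 * g 6
        + (2520 * (16 * Y - 1)) * g 7
      - 10080 * (3840 * q5 + 115200 * q6)"
    unfolding q_defs M a3 a4 a2 g_values unfolding ae
    by (simp add: algebra_simps power2_eq_square; intro dvd_add dvd_diff; simp)
  ultimately have "[B 1 * g 6 + B 2 * g 7
      = M * (3840 * q5 + 115200 * q6)] (mod 2 ^ (n + 15))"
    by (rule cancel)
  then show "[(\<Sum>s=1..7 - 5. int ((16 * y) choose s) * even_euler_diff a (5 + s))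
      = M * (3840 * q5 + 115200 * q6)] (mod 2 ^ (n + 15))"
    by (simp add: eval_nat_numeral g_def B_def)
  have "315 * (B 1 * g 7)
      = Y * (5040 * g 7)"
    using B_values by (simp only: distrib_left mult.assoc[symmetric])
  moreover have "32768 dvd 5040 * g 7
      - 10080 * (46080 * q6)"
    unfolding q_defs M a3 a4 a2 g_values unfolding ae
    by (simp add: algebra_simps power2_eq_square; intro dvd_add dvd_diff; simp)
  ultimately have "[B 1 * g 7
      = M * (46080 * q6)] (mod 2 ^ (n + 15))"
    by (rule cancel)
  then show "[(\<Sum>s=1..7 - 6. int ((16 * y) choose s) * even_euler_diff a (6 + s))
      = M * (46080 * q6)] (mod 2 ^ (n + 15))"
    by (simp add: eval_nat_numeral g_def B_def)
qed

section \<open>Truncation of the double sum and the final congruence\<close>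

lemma gen_euler_cong_truncated:
  assumes "odd a"
  shows "[gen_euler a (2 * (2 ^ n * 16 * k + c)) - gen_euler a (2 * c)
    = (\<Sum>i\<le>6. int (c choose i) *
        (\<Sum>s=1..7 - i. int ((2 ^ n * 16 * k) choose s) * even_euler_diff a (i + s)))] (mod 2 ^ (n + 15))"
proof (cases "k = 0")
  case True
  then show ?thesis
    by (simp add: binomial_eq_0)
next
  case False
  define K where "K = 2 ^ n * 16 * k"
  define t where "t = (\<lambda>i s. int (K choose s) * even_euler_diff a (i + s))"
  \<comment> \<open>This puts each range \<open>{1..7 - i}\<close> inside \<open>{1..K}\<close>, so
    that the discarded terms form a difference of sums.\<close>
  have "16 \<le> K"
    using False by (simp add: K_def)
  have K: "2 ^ (n + 4) dvd K"
    by (simp add: K_def power_add)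
  have inner: "[(\<Sum>s=1..K. t i s) = (\<Sum>s=1..7 - i. t i s)] (mod 2 ^ (n + 15))" for i
  proof -
    have "2 ^ (n + 15) dvd t i s" if s: "s \<in> {1..K} - {1..7 - i}" for s
    proof -
      have "8 \<le> i + s"
        using s by auto
      then show ?thesis
        using two_power_dvd_binomial_mult_even_euler_diff[OF \<open>odd a\<close> _ _ _ K, of "i + s" s] s
        by (simp add: t_def add_ac)
    qed
    then have "2 ^ (n + 15) dvd (\<Sum>s\<in>{1..K} - {1..7 - i}. t i s)"
      by (rule dvd_sum)
    also have "\<dots> = (\<Sum>s=1..K. t i s) - (\<Sum>s=1..7 - i. t i s)"
      using \<open>16 \<le> K\<close> by (intro sum_diff) auto
    finally show ?thesis
      by (simp add: cong_iff_dvd_diff)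
  qed
  have "gen_euler a (2 * (K + c)) - gen_euler a (2 * c)
      = (\<Sum>i\<le>c. int (c choose i) * (\<Sum>s=1..K. t i s))"
    unfolding gen_euler_even_diff t_def ..
  also have "[\<dots> = (\<Sum>i\<le>c. int (c choose i) * (\<Sum>s=1..7 - i. t i s))] (mod 2 ^ (n + 15))"
    by (intro cong_sum cong_scalar_left inner)
  \<comment> \<open>The outer range is changed through the union: beyond \<open>c\<close> the
    binomial coefficient vanishes, and beyond 6 the inner sum is empty because \<open>7 - i\<close>
    is 0.\<close>
  also have "(\<Sum>i\<le>c. int (c choose i) * (\<Sum>s=1..7 - i. t i s))
      = (\<Sum>i\<in>{..c} \<union> {..6}. int (c choose i) * (\<Sum>s=1..7 - i. t i s))"
    by (intro sum.mono_neutral_left) (auto simp: binomial_eq_0)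
  also have "\<dots> = (\<Sum>i\<le>6. int (c choose i) * (\<Sum>s=1..7 - i. t i s))"
    by (intro sum.mono_neutral_right) auto
  finally show ?thesis
    by (simp add: K_def t_def)
qed

theorem theorem2p2:
  fixes a :: int and k m b :: nat
  assumes "odd a" and "k > 0" and "m \<ge> 5" and "even b"
  shows "[gen_euler a (2 ^ m * k + b) - gen_euler a b =
     2 ^ m * int k *
       (7 * a * int b ^ 6 - 6 * a * int b ^ 5 + (3 * a ^ 3 - 14 * a) * int b ^ 4
        + (4 * a ^ 3 + 56 * a) * int b ^ 3
        - (6 * a ^ 4 + 35 * a ^ 3 - 12 * a ^ 2 + 106 * a - 122) * int b ^ 2
        + (38 * a ^ 3 - 8 * a - 256) * int b
        + (70 * a ^ 3 + 64 * a ^ 2 - 81 * a + 448)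
        + 2 ^ m * int k *
            (int b ^ 4 + 2 * int b ^ 3 + 2 * a * int b ^ 2 + (a ^ 3 + 2 * a) * int b + 16 - a ^ 3))]
     (mod 2 ^ (m + 10))"
proof -
  \<comment> \<open>Half of \<open>2 ^ m * k\<close> is then \<open>16 * y\<close>, the form treated
    in \<open>binomial_16_mult\<close>, and the modulus is \<open>2 ^ (n + 15)\<close>.\<close>
  obtain n where m: "m = n + 5"
    using \<open>m \<ge> 5\<close> by (metis add.commute le_Suc_ex)
  obtain c where b: "b = 2 * c"
    using \<open>even b\<close> by (elim evenE)
  define y where "y = 2 ^ n * k"
  define M where "M = 32 * int y"
  \<comment> \<open>Each \<open>q\<close> collects the full coefficient of one power of
    \<open>b\<close>, the part multiplied by \<open>M\<close> included.\<close>
  define q0 where "q0 = 70 * a ^ 3 + 64 * a\<^sup>2 - 81 * a + 448 + M * (16 - a ^ 3)"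
  define q1 where "q1 = 38 * a ^ 3 - 8 * a - 256 + M * (a ^ 3 + 2 * a)"
  define q2 where "q2 = - (6 * a ^ 4 + 35 * a ^ 3 - 12 * a\<^sup>2 + 106 * a - 122) + 2 * M * a"
  define q3 where "q3 = 4 * a ^ 3 + 56 * a + 2 * M"
  define q4 where "q4 = 3 * a ^ 3 - 14 * a + M"
  define q5 where "q5 = - 6 * a"
  define q6 where "q6 = 7 * a"
  note q_defs = q0_def q1_def q2_def q3_def q4_def q5_def q6_def
  define C where "C = (\<lambda>i. int (c choose i))"
  note tr = truncated_sum_cong[OF \<open>odd a\<close> y_def, folded M_def, folded q_defs]
  have M_eq: "2 ^ m * int k = M"
    by (simp add: M_def m y_def power_add)
  have index: "2 ^ m * k + b = 2 * (2 ^ n * 16 * k + c)" and y16: "2 ^ n * 16 * k = 16 * y"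
    by (simp_all add: m b y_def power_add)
  have "[gen_euler a (2 ^ m * k + b) - gen_euler a b
      = (\<Sum>i\<le>6. C i * (\<Sum>s=1..7 - i. int ((16 * y) choose s) * even_euler_diff a (i + s)))]
      (mod 2 ^ (m + 10))"
    using gen_euler_cong_truncated[OF \<open>odd a\<close>, of n k c]
    unfolding index unfolding y16 b m C_def by (simp add: add.assoc)
  also have "(\<Sum>i\<le>6. C i * (\<Sum>s=1..7 - i. int ((16 * y) choose s) * even_euler_diff a (i + s)))
      = C 0 * (\<Sum>s=1..7 - 0. int ((16 * y) choose s) * even_euler_diff a (0 + s))
        + C 1 * (\<Sum>s=1..7 - 1. int ((16 * y) choose s) * even_euler_diff a (1 + s))
        + C 2 * (\<Sum>s=1..7 - 2. int ((16 * y) choose s) * even_euler_diff a (2 + s))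
        + C 3 * (\<Sum>s=1..7 - 3. int ((16 * y) choose s) * even_euler_diff a (3 + s))
        + C 4 * (\<Sum>s=1..7 - 4. int ((16 * y) choose s) * even_euler_diff a (4 + s))
        + C 5 * (\<Sum>s=1..7 - 5. int ((16 * y) choose s) * even_euler_diff a (5 + s))
        + C 6 * (\<Sum>s=1..7 - 6. int ((16 * y) choose s) * even_euler_diff a (6 + s))"
    by (simp add: atMost_nat_numeral numeral_2_eq_2 numeral_3_eq_3)
  also have "[\<dots> = C 0 * (M * q0)
        + C 1 * (M * (2 * q1 + 4 * q2 + 8 * q3 + 16 * q4 + 32 * q5 + 64 * q6))
        + C 2 * (M * (8 * q2 + 48 * q3 + 224 * q4 + 960 * q5 + 3968 * q6))
        + C 3 * (M * (48 * q3 + 576 * q4 + 4800 * q5 + 34560 * q6))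
        + C 4 * (M * (384 * q4 + 7680 * q5 + 99840 * q6))
        + C 5 * (M * (3840 * q5 + 115200 * q6))
        + C 6 * (M * (46080 * q6))]
      (mod 2 ^ (m + 10))"
    unfolding m add.assoc[of n] by (intro cong_add cong_scalar_left) (use tr in simp_all)
  \<comment> \<open>Newton expansion read backwards: as \<open>b = 2 c\<close>, the
    \<open>n\<close>-th power of \<open>b\<close> contributes \<open>2 ^ n\<close> times the
    coefficients in \<open>power_newton_expansion\<close>.\<close>
  also have "C 0 * (M * q0)
        + C 1 * (M * (2 * q1 + 4 * q2 + 8 * q3 + 16 * q4 + 32 * q5 + 64 * q6))
        + C 2 * (M * (8 * q2 + 48 * q3 + 224 * q4 + 960 * q5 + 3968 * q6))
        + C 3 * (M * (48 * q3 + 576 * q4 + 4800 * q5 + 34560 * q6))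
        + C 4 * (M * (384 * q4 + 7680 * q5 + 99840 * q6))
        + C 5 * (M * (3840 * q5 + 115200 * q6))
        + C 6 * (M * (46080 * q6))
      = M * (q0 + q1 * int b + q2 * int b ^ 2 + q3 * int b ^ 3 + q4 * int b ^ 4
      + q5 * int b ^ 5 + q6 * int b ^ 6)"
    unfolding b of_nat_mult power_mult_distrib
    unfolding power_newton_expansion(2-6)[of c] by (simp add: C_def algebra_simps)
  also have "\<dots> = 2 ^ m * int k *
       (7 * a * int b ^ 6 - 6 * a * int b ^ 5 + (3 * a ^ 3 - 14 * a) * int b ^ 4
        + (4 * a ^ 3 + 56 * a) * int b ^ 3
        - (6 * a ^ 4 + 35 * a ^ 3 - 12 * a ^ 2 + 106 * a - 122) * int b ^ 2
        + (38 * a ^ 3 - 8 * a - 256) * int b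
        + (70 * a ^ 3 + 64 * a ^ 2 - 81 * a + 448)
        + 2 ^ m * int k *
            (int b ^ 4 + 2 * int b ^ 3 + 2 * a * int b ^ 2 + (a ^ 3 + 2 * a) * int b + 16 - a ^ 3))"
    unfolding M_eq q_defs by (simp add: algebra_simps)
  finally show ?thesis .
qed

end
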